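(* The Kauffman bracket polynomial $\langle G\rangle(a)$ of a labeled graph $G$ is invariant under the graph-moves $\Omega_g2$, $\Omega_g3$, $\Omega_g4$ and $\Omega_g4'$, and it is multiplied by $-a^{\pm3}$ (that is, by $-a^{3}$ or by $-a^{-3}$) under the graph-move $\Omega_g1$.
   Context: All graphs are finite. A labeled graph is a simple graph each of whose vertices $v$ is endowed with a pair $(b,\alpha)$, where $b\in\{0,1\}$ is the framing and $\alpha\in\{+,-\}$ the sign of $v$. $N(v)$ is the set of neighbours of $v$. The local complementation $\operatorname{LC}(G;v)$ toggles adjacency of every pair $x\ne y$ in $N(v)$. The pivot $\operatorname{piv}(G;u,v)$ toggles adjacency of every pair $x,y\notin\{u,v\}$ with $x\in N(u)$, $y\in N(v)$ and ($x\notin N(v)$ or $y\notin N(u)$). Graph-moves. $\Omega_g1$: addition/removal of an isolated vertex labeled $(0,\alpha)$, $\alpha\in\{\pm\}$. $\Omega_g2$: addition/removal of two non-adjacent vertices labeled $(0,+)$ and $(0,-)$ (resp. two adjacent vertices labeled $(1,+)$ and $(1,-)$) having the same adjacencies with all other vertices. $\Omega_g3$: let $u,v,w$ be three vertices all labeled $(0,-)$ such that $u$ is adjacent only to $v$ and $w$; change the adjacency of $u$ with each $t\in(N(v)\setminus N(w))\cup(N(w)\setminus N(v))$ and switch the signs of $v$ and $w$ to $+$; the inverse operation is also called $\Omega_g3$. $\Omega_g4$: for adjacent vertices $u,v$ labeled $(0,\alpha)$ and $(0,\beta)$, replace $G$ by $\operatorname{piv}(G;u,v)$ and change signs so that $u$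 gets sign $-\beta$ and $v$ gets sign $-\alpha$. $\Omega_g4'$: for a vertex $v$ labeled $(1,\alpha)$, replace $G$ by $\operatorname{LC}(G;v)$, change the sign of $v$, and change the framing of each $u\in N(v)$. For a labeled graph $G$, $A(G)$ is the symmetric $\mathbb{Z}_2$-matrix with $a_{ii}$ the framing of $v_i$ and, for $i\neq j$, $a_{ij}=1$ iff $v_i,v_j$ are adjacent. A state is a subset $s\subset V(G)$; $G(s)$ is the induced labeled subgraph on $s$. The Kauffman bracket polynomial is $$\langle G\rangle(a)=\sum_{s}a^{\alpha(s)-\beta(s)}(-a^2-a^{-2})^{\operatorname{corank}_{\mathbb{Z}_2} A(G(s))},$$ the sum over all states $s\subset V(G)$, where $\alpha(s)$ is the number of vertices of sign $-$ in $s$ plus the number of vertices of sign $+$ in $V(G)\setminus s$, and $\beta(s)=|V(G)|-\alpha(s)$; the corank of the empty matrix is $0$.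
   Formalization: In Ω_g3, u is made adjacent exactly to the vertices of (N(v)\N(w))∪(N(w)\N(v)), i.e. its adjacency with v and w is toggled in addition; merely toggling u with that set changes the bracket, e.g. on the path v,u,w. *)

theory Defs
  imports
    "HOL-Library.Z2"
    "HOL-Library.Poly_Mapping"
    "Jordan_Normal_Form.DL_Rank"
begin

section \<open>Labeled graphs\<close>

datatype vsign = Plus | Minus

fun flip_sign :: "vsign \<Rightarrow> vsign" where
  "flip_sign Plus = Minus"
| "flip_sign Minus = Plus"

record 'v lgraph =
  verts :: "'v set"
  adjacent :: "'v \<Rightarrow> 'v \<Rightarrow> bool"
  framing :: "'v \<Rightarrow> bit"
  vsign :: "'v \<Rightarrow> vsign"

definition labeled_graph :: "'v lgraph \<Rightarrow> bool" where
  "labeled_graph G \<longleftrightarrow> finite (verts G) \<and>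
     (\<forall>x y. adjacent G x y \<longrightarrow>
        x \<in> verts G \<and> y \<in> verts G \<and> x \<noteq> y \<and> adjacent G y x)"

text \<open>The fields \<open>framing\<close> and \<open>vsign\<close> are total functions whose values outside the vertex
  set carry no meaning, so equality of labeled graphs is agreement on the vertex set.\<close>

definition same_lgraph :: "'v lgraph \<Rightarrow> 'v lgraph \<Rightarrow> bool" (infix "\<doteq>" 50) where
  "G \<doteq> H \<longleftrightarrow> verts G = verts H \<and>
     (\<forall>x \<in> verts G. \<forall>y \<in> verts G. adjacent G x y = adjacent H x y) \<and>
     (\<forall>x \<in> verts G. framing G x = framing H x \<and> vsign G x = vsign H x)"

definition nbhd :: "'v lgraph \<Rightarrow> 'v \<Rightarrow> 'v set" where
  "nbhd G v = {x \<in> verts G. adjacent G v x}"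

definition induced :: "'v lgraph \<Rightarrow> 'v set \<Rightarrow> 'v lgraph" where
  "induced G s = G\<lparr>verts := s, adjacent := (\<lambda>x y. x \<in> s \<and> y \<in> s \<and> adjacent G x y)\<rparr>"

text \<open>\<open>P\<close> is to be symmetric and irreflexive.\<close>

definition toggle_adjacency :: "'v lgraph \<Rightarrow> ('v \<Rightarrow> 'v \<Rightarrow> bool) \<Rightarrow> 'v lgraph" where
  "toggle_adjacency G P =
     G\<lparr>adjacent := (\<lambda>x y. if P x y then \<not> adjacent G x y else adjacent G x y)\<rparr>"

definition local_complementation :: "'v lgraph \<Rightarrow> 'v \<Rightarrow> 'v lgraph" where
  "local_complementation G v =
     toggle_adjacency G (\<lambda>x y. x \<in> nbhd G v \<and> y \<in> nbhd G v \<and> x \<noteq> y)"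

text \<open>The pivot condition on a pair is not symmetric in its two entries; an unordered pair is
  toggled if the condition holds for one of its two orderings. It never holds for both
  orderings, nor for \<open>x = y\<close>.\<close>

definition pivot_pair :: "'v lgraph \<Rightarrow> 'v \<Rightarrow> 'v \<Rightarrow> 'v \<Rightarrow> 'v \<Rightarrow> bool" where
  "pivot_pair G u v x y \<longleftrightarrow> x \<notin> {u, v} \<and> y \<notin> {u, v} \<and>
     x \<in> nbhd G u \<and> y \<in> nbhd G v \<and> (x \<notin> nbhd G v \<or> y \<notin> nbhd G u)"

definition pivot :: "'v lgraph \<Rightarrow> 'v \<Rightarrow> 'v \<Rightarrow> 'v lgraph" where
  "pivot G u v = toggle_adjacency G (\<lambda>x y. pivot_pair G u v x y \<or> pivot_pair G u v y x)"

section \<open>Graph-moves\<close>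

text \<open>Vertices are concrete elements of the type \<open>'v\<close>, so a move that adds vertices may choose
  any names not yet in use; no identification up to isomorphism is made.\<close>

definition omega_g1_removal :: "'v lgraph \<Rightarrow> 'v lgraph \<Rightarrow> bool" where
  "omega_g1_removal G H \<longleftrightarrow>
     (\<exists>v \<in> verts G. framing G v = 0 \<and> nbhd G v = {} \<and> H \<doteq> induced G (verts G - {v}))"

definition omega_g1 :: "'v lgraph \<Rightarrow> 'v lgraph \<Rightarrow> bool" where
  "omega_g1 G H \<longleftrightarrow> omega_g1_removal G H \<or> omega_g1_removal H G"

definition omega_g2_removal :: "'v lgraph \<Rightarrow> 'v lgraph \<Rightarrow> bool" where
  "omega_g2_removal G H \<longleftrightarrow>
     (\<exists>x \<in> verts G. \<exists>y \<in> verts G. x \<noteq> y \<and> vsign G x = Plus \<and> vsign G y = Minus \<and>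
        ((\<not> adjacent G x y \<and> framing G x = 0 \<and> framing G y = 0) \<or>
         (adjacent G x y \<and> framing G x = 1 \<and> framing G y = 1)) \<and>
        (\<forall>t \<in> verts G - {x, y}. adjacent G x t = adjacent G y t) \<and>
        H \<doteq> induced G (verts G - {x, y}))"

definition omega_g2 :: "'v lgraph \<Rightarrow> 'v lgraph \<Rightarrow> bool" where
  "omega_g2 G H \<longleftrightarrow> omega_g2_removal G H \<or> omega_g2_removal H G"

definition set_nbhd :: "'v lgraph \<Rightarrow> 'v \<Rightarrow> 'v set \<Rightarrow> 'v lgraph" where
  "set_nbhd G u T = G\<lparr>adjacent :=
     (\<lambda>x y. if x = u then y \<in> T else if y = u then x \<in> T else adjacent G x y)\<rparr>"

text \<open>In the third move the adjacency of \<open>u\<close> is changed so that \<open>u\<close> becomes adjacent exactly to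
  the vertices adjacent to precisely one of \<open>v\<close> and \<open>w\<close>; in particular \<open>u\<close> is disconnected from
  \<open>v\<close> and \<open>w\<close> if these are not adjacent to each other. Merely toggling the adjacency of \<open>u\<close> with
  the vertices of that set (which would keep the edges \<open>uv\<close> and \<open>uw\<close> in this case) is not
  intended: on the path with the three vertices \<open>v\<close>, \<open>u\<close>, \<open>w\<close> it would change nothing but
  the signs of \<open>v\<close> and \<open>w\<close>, which alters the Kauffman bracket polynomial.\<close>

definition omega_g3_step :: "'v lgraph \<Rightarrow> 'v lgraph \<Rightarrow> bool" where
  "omega_g3_step G H \<longleftrightarrow>
     (\<exists>u \<in> verts G. \<exists>v \<in> verts G. \<exists>w \<in> verts G. u \<noteq> v \<and> u \<noteq> w \<and> v \<noteq> w \<and>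
        (\<forall>x \<in> {u, v, w}. framing G x = 0 \<and> vsign G x = Minus) \<and>
        nbhd G u = {v, w} \<and>
        H \<doteq> (set_nbhd G u ((nbhd G v - nbhd G w) \<union> (nbhd G w - nbhd G v)))
               \<lparr>vsign := (vsign G)(v := Plus, w := Plus)\<rparr>)"

definition omega_g3 :: "'v lgraph \<Rightarrow> 'v lgraph \<Rightarrow> bool" where
  "omega_g3 G H \<longleftrightarrow> omega_g3_step G H \<or> omega_g3_step H G"

definition omega_g4 :: "'v lgraph \<Rightarrow> 'v lgraph \<Rightarrow> bool" where
  "omega_g4 G H \<longleftrightarrow>
     (\<exists>u \<in> verts G. \<exists>v \<in> verts G. adjacent G u v \<and> framing G u = 0 \<and> framing G v = 0 \<and>
        H \<doteq> (pivot G u v)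
               \<lparr>vsign := (vsign G)(u := flip_sign (vsign G v), v := flip_sign (vsign G u))\<rparr>)"

definition omega_g4' :: "'v lgraph \<Rightarrow> 'v lgraph \<Rightarrow> bool" where
  "omega_g4' G H \<longleftrightarrow>
     (\<exists>v \<in> verts G. framing G v = 1 \<and>
        H \<doteq> (local_complementation G v)
               \<lparr>vsign := (vsign G)(v := flip_sign (vsign G v)),
                framing := (\<lambda>x. if x \<in> nbhd G v then framing G x + 1 else framing G x)\<rparr>)"

section \<open>The Kauffman bracket polynomial\<close>

definition adjacency_matrix :: "'v lgraph \<Rightarrow> 'v list \<Rightarrow> bit mat" where
  "adjacency_matrix G vs = mat (length vs) (length vs)
     (\<lambda>(i, j). if i = j then framing G (vs ! i) else of_bool (adjacent G (vs ! i) (vs ! j)))"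

definition mat_corank :: "'a::field mat \<Rightarrow> nat" where
  "mat_corank A = dim_row A - vec_space.rank (dim_row A) A"

text \<open>Another enumeration of the vertices permutes rows and columns simultaneously, so the
  corank does not depend on the one that is chosen.\<close>

definition lgraph_corank :: "'v lgraph \<Rightarrow> nat" where
  "lgraph_corank G =
     mat_corank (adjacency_matrix G (SOME vs. distinct vs \<and> set vs = verts G))"

text \<open>Integer Laurent polynomials in one variable \<open>a\<close>: the group ring of the exponent group
  \<open>int\<close>, that is, finitely supported coefficient functions with the convolution product.\<close>

type_synonym laurent_poly = "int \<Rightarrow>\<^sub>0 int"

definition a_pow :: "int \<Rightarrow> laurent_poly" where
  "a_pow k = Poly_Mapping.single k 1"

definition state_alpha :: "'v lgraph \<Rightarrow> 'v set \<Rightarrow> nat" where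
  "state_alpha G s = card {v \<in> s. vsign G v = Minus} + card {v \<in> verts G - s. vsign G v = Plus}"

definition state_beta :: "'v lgraph \<Rightarrow> 'v set \<Rightarrow> nat" where
  "state_beta G s = card (verts G) - state_alpha G s"

definition kauffman_bracket :: "'v lgraph \<Rightarrow> laurent_poly" where
  "kauffman_bracket G =
     (\<Sum>s \<in> Pow (verts G). a_pow (int (state_alpha G s) - int (state_beta G s)) *
        (- a_pow 2 - a_pow (-2)) ^ lgraph_corank (induced G s))"

end

theory Submission
  imports Defs "Jordan_Normal_Form.Matrix_Kernel"
begin

text \<open>
  Over the two-element field the kernel of a matrix of corank \<open>c\<close> has \<open>2\<^sup>c\<close> elements, so coranks can
  be compared by bijections between kernels (\<open>card_form_kernel\<close>, \<open>corank_eq_of_bij\<close>). For a state \<open>s\<close> a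
  kernel vector is a function \<open>f\<close> on all vertices such that \<open>(M f) x = 0\<close> for \<open>x\<close> in \<open>s\<close> and
  \<open>f x = 0\<close> for \<open>x\<close> outside of \<open>s\<close>, where \<open>M\<close> is the adjacency matrix with the framings on the diagonal.

  The moves \<open>\<Omega>\<^sub>g4\<close> and \<open>\<Omega>\<^sub>g4'\<close> replace \<open>M\<close> by a principal pivot transform, which interchanges the
  coordinates of \<open>f\<close> and \<open>M f\<close> at the vertices of the move. Hence the corank of the new matrix on a
  state equals the corank of the old matrix on the state with the memberships of these vertices
  switched, where \<open>\<Omega>\<^sub>g4\<close> in addition exchanges the roles of its two vertices
  (\<open>corank_pivot_form\<close>, \<open>corank_lc_form\<close>). As the signs of the same vertices change accordingly,
  corresponding states also have the same power of \<open>a\<close>, and the two state sums agree term by term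
  after reindexing.

  For the other moves all states with the same trace outside the vertices of the move are collected.
  Their coranks are related by two facts: deleting a vertex in the support of a kernel vector lowers
  the corank by one (\<open>corank_insert_of_form_kernel\<close>), and pivoting at an edge with two unframed
  ends removes these ends from the state. What remains is an identity of Laurent polynomials in which
  \<open>- a\<^sup>2 - a\<^sup>-\<^sup>2\<close> cancels against \<open>a\<^sup>2\<close> and \<open>a\<^sup>-\<^sup>2\<close> (\<open>twin_states_cancel\<close>,
  \<open>third_move_states\<close>).
\<close>

section \<open>Counting the kernel of a matrix over a finite field\<close>

text \<open>Over a finite field a basis identifies the space with the set of all coordinate functions on
  it, so cardinalities record dimensions. This is what turns every comparison of coranks below
  into a bijection between two sets of kernel vectors.\<close>

lemma (in vectorspace) card_carrier_eq_power_dim: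
  assumes "fin_dim" and "finite (carrier K)"
  shows "card (carrier V) = card (carrier K) ^ dim"
proof -
  obtain B where B: "finite B" "basis B"
    using finite_basis_exists assms(1) by blast
  have BV: "B \<subseteq> carrier V" using B(2) by (simp add: basis_def)
  have ex1: "\<exists>!a. a \<in> B \<rightarrow>\<^sub>E carrier K \<and> lincomb a B = v" if "v \<in> carrier V" for v
    using basis_criterion[OF B(1) BV] B(2) that by blast
  have "lincomb a B \<in> carrier V" if "a \<in> B \<rightarrow>\<^sub>E carrier K" for a
    using that BV by (intro lincomb_closed) (auto simp: PiE_def)
  then have "bij_betw (\<lambda>a. lincomb a B) (B \<rightarrow>\<^sub>E carrier K) (carrier V)"
    using ex1 by (intro bij_betw_imageI inj_onI) (auto simp: image_iff, metis+)
  then have "card (carrier V) = card (B \<rightarrow>\<^sub>E carrier K)"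
    by (simp add: bij_betw_same_card)
  also have "\<dots> = card (carrier K) ^ card B"
    using B(1) by (simp add: card_PiE)
  finally show ?thesis using dim_basis[OF B] by simp
qed

lemma (in vec_space) span_cols_eq_range:
  assumes A: "A \<in> carrier_mat n nc"
  shows "span (set (cols A)) = (\<lambda>v. A *\<^sub>v v) ` carrier_vec nc"
proof -
  have cols: "set (cols A) \<subseteq> carrier_vec n" and len: "length (cols A) = nc"
    using A cols_dim[of A] by auto
  have mat: "mat_of_cols n (cols A) = A" using A by auto
  have "span (set (cols A)) = span_list (cols A)"
    using cols by (simp add: span_list_as_span)
  also have "\<dots> = (\<lambda>c. A *\<^sub>v vec nc c) ` UNIV"
  proof -
    have "lincomb_list c (cols A) = A *\<^sub>v vec nc c" for c
      using lincomb_list_as_mat_mult[of "cols A" c] cols len mat by (metis carrier_vecD subsetD)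
    then show ?thesis by (auto simp: span_list_def)
  qed
  also have "\<dots> = (\<lambda>v. A *\<^sub>v v) ` carrier_vec nc"
  proof (intro equalityI image_subsetI)
    fix v :: "'a vec" assume "v \<in> carrier_vec nc"
    then have "v = vec nc (\<lambda>i. v $ i)" by auto
    then show "A *\<^sub>v v \<in> range (\<lambda>c. A *\<^sub>v vec nc c)" by (metis rangeI)
  qed auto
  finally show ?thesis .
qed

text \<open>Every fibre of \<open>v \<mapsto> A v\<close> over its range is a translate of the kernel.\<close>

lemma card_mat_kernel_times_range:
  fixes A :: "'a::field mat"
  assumes A: "A \<in> carrier_mat nr nc"
  shows "card (mat_kernel A) * card ((\<lambda>v. A *\<^sub>v v) ` carrier_vec nc) = card (carrier_vec nc :: 'a vec set)"
proof -
  (* sigma picks one point of each fibre; k + sigma w is then the general point of the fibre over w *)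
  define \<sigma> where "\<sigma> = inv_into (carrier_vec nc) (\<lambda>v. A *\<^sub>v v)"
  have \<sigma>: "\<sigma> w \<in> carrier_vec nc" "A *\<^sub>v \<sigma> w = w" if "w \<in> (\<lambda>v. A *\<^sub>v v) ` carrier_vec nc" for w
    using that inv_into_into[of w "\<lambda>v. A *\<^sub>v v" "carrier_vec nc"]
      f_inv_into_f[of w "\<lambda>v. A *\<^sub>v v" "carrier_vec nc"] by (auto simp: \<sigma>_def)
  have add: "A *\<^sub>v (k + \<sigma> w) = w"
    if "k \<in> mat_kernel A" "w \<in> (\<lambda>v. A *\<^sub>v v) ` carrier_vec nc" for k w
    using that \<sigma>[OF that(2)] mult_add_distrib_mat_vec[OF A] mat_kernelD[OF A] A
    by (metis left_zero_vec mult_mat_vec_carrier)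
  have "bij_betw (\<lambda>(k, w). k + \<sigma> w) (mat_kernel A \<times> (\<lambda>v. A *\<^sub>v v) ` carrier_vec nc) (carrier_vec nc)"
  proof (rule bij_betwI[where g = "\<lambda>v. (v - \<sigma> (A *\<^sub>v v), A *\<^sub>v v)"])
    show "(\<lambda>(k, w). k + \<sigma> w) \<in> mat_kernel A \<times> (\<lambda>v. A *\<^sub>v v) ` carrier_vec nc \<rightarrow> carrier_vec nc"
      using \<sigma>(1) mat_kernelD(1)[OF A] by (auto simp del: index_mult_mat_vec)
    show "(\<lambda>v. (v - \<sigma> (A *\<^sub>v v), A *\<^sub>v v)) \<in> carrier_vec nc \<rightarrow> mat_kernel A \<times> (\<lambda>v. A *\<^sub>v v) ` carrier_vec nc"
    proof
      fix v :: "'a vec" assume v: "v \<in> carrier_vec nc"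
      then have s: "\<sigma> (A *\<^sub>v v) \<in> carrier_vec nc" "A *\<^sub>v \<sigma> (A *\<^sub>v v) = A *\<^sub>v v" using \<sigma>[of "A *\<^sub>v v"] by auto
      have "A *\<^sub>v (v - \<sigma> (A *\<^sub>v v)) = A *\<^sub>v v - A *\<^sub>v \<sigma> (A *\<^sub>v v)"
        using mult_minus_distrib_mat_vec[OF A v s(1)] .
      then have "A *\<^sub>v (v - \<sigma> (A *\<^sub>v v)) = 0\<^sub>v nr"
        using s(2) mult_mat_vec_carrier[OF A v] by simp
      then show "(v - \<sigma> (A *\<^sub>v v), A *\<^sub>v v) \<in> mat_kernel A \<times> (\<lambda>v. A *\<^sub>v v) ` carrier_vec nc"
        using A v s(1) by (auto intro!: mat_kernelI[OF A])
    qed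
    fix p assume "p \<in> mat_kernel A \<times> (\<lambda>v. A *\<^sub>v v) ` carrier_vec nc"
    then obtain k w where p: "p = (k, w)" "k \<in> mat_kernel A" "w \<in> (\<lambda>v. A *\<^sub>v v) ` carrier_vec nc"
      by blast
    have "k + \<sigma> w - \<sigma> w = k"
      using \<sigma>(1)[OF p(3)] mat_kernelD(1)[OF A p(2)] by auto
    then show "(\<lambda>v. (v - \<sigma> (A *\<^sub>v v), A *\<^sub>v v)) (case p of (k, w) \<Rightarrow> k + \<sigma> w) = p"
      using add[OF p(2,3)] by (simp add: p(1))
  next
    fix v :: "'a vec" assume "v \<in> carrier_vec nc"
    then show "(case (v - \<sigma> (A *\<^sub>v v), A *\<^sub>v v) of (k, w) \<Rightarrow> k + \<sigma> w) = v"
      using \<sigma>(1)[of "A *\<^sub>v v"] by auto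
  qed
  then show ?thesis by (simp add: bij_betw_same_card[symmetric] card_cartesian_product)
qed

lemma card_mat_kernel_eq_power_corank:
  fixes A :: "'a::field mat"
  assumes finK: "finite (UNIV :: 'a set)" and A: "A \<in> carrier_mat n n"
  shows "card (mat_kernel A) = card (UNIV :: 'a set) ^ mat_corank A"
proof -
  interpret vec_space "TYPE('a)" n .
  have K: "carrier (class_ring :: 'a ring) = UNIV" by simp
  have "vectorspace class_ring (span_vs (set (cols A)))"
    using A cols_dim[of A] by (intro subspace_is_vs span_is_subspace) auto
  then have "card (span (set (cols A))) = card (UNIV :: 'a set) ^ rank A"
    using vectorspace.card_carrier_eq_power_dim[OF _ fin_dim_span_cols[OF A]] finK by (simp add: rank_def)
  moreover have "card (carrier_vec n :: 'a vec set) = card (UNIV :: 'a set) ^ n"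
    using card_carrier_eq_power_dim finK by (simp add: dim_is_n)
  ultimately have *: "card (mat_kernel A) * card (UNIV :: 'a set) ^ rank A = card (UNIV :: 'a set) ^ n"
    using card_mat_kernel_times_range[OF A] span_cols_eq_range[OF A] by simp
  have "n = mat_corank A + rank A"
    using A rank_le_nc[OF A] by (simp add: mat_corank_def)
  with * have "card (mat_kernel A) * card (UNIV :: 'a set) ^ rank A = card (UNIV :: 'a set) ^ mat_corank A * card (UNIV :: 'a set) ^ rank A"
    by (metis power_add)
  moreover have "card (UNIV :: 'a set) \<noteq> 0" using finK by simp
  ultimately show ?thesis by simp
qed

section \<open>Coranks of vertex-indexed matrices\<close>

(* The default rules turn sums and products of bits into bitwise operations, on which the ring
   normalisation and the lemmas on finite sums do not act. *)
declare add_bit_eq_xor [simp del] mult_bit_eq_and [simp del]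

lemma bit_add_self [simp]: "b + b = (0::bit)" by (cases b) simp_all

lemma bit_add_self_left [simp]: "b + (b + c) = (c::bit)"
  by (simp flip: add.assoc)

definition form_matrix :: "('v \<Rightarrow> 'v \<Rightarrow> 'a) \<Rightarrow> 'v list \<Rightarrow> 'a mat" where
  "form_matrix M vs = mat (length vs) (length vs) (\<lambda>(i, j). M (vs ! i) (vs ! j))"

text \<open>Matrices over the two-element field are handled as functions of two vertices and
  restricted to vertex sets, so that the same matrix can be studied on many states at once.
  The enumeration is chosen as for labeled graphs, so that the coranks of induced subgraphs are
  an instance.\<close>

definition corank :: "('v \<Rightarrow> 'v \<Rightarrow> bit) \<Rightarrow> 'v set \<Rightarrow> nat" where
  "corank M s = mat_corank (form_matrix M (SOME vs. distinct vs \<and> set vs = s))"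

definition form_apply :: "('v \<Rightarrow> 'v \<Rightarrow> bit) \<Rightarrow> 'v set \<Rightarrow> ('v \<Rightarrow> bit) \<Rightarrow> 'v \<Rightarrow> bit" where
  "form_apply M V f x = (\<Sum>y\<in>V. M x y * f y)"

text \<open>Kernel vectors of the restriction to \<open>s\<close>, extended by zero. The extension makes the kernels
  for different states subsets of one and the same function space.\<close>

definition form_kernel :: "('v \<Rightarrow> 'v \<Rightarrow> bit) \<Rightarrow> 'v set \<Rightarrow> ('v \<Rightarrow> bit) set" where
  "form_kernel M s = {f. (\<forall>x. x \<notin> s \<longrightarrow> f x = 0) \<and> (\<forall>x\<in>s. form_apply M s f x = 0)}"

text \<open>Reading off coordinates along an enumeration identifies the two kernels; in particular the
  right-hand side is the same for all enumerations.\<close>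

lemma card_form_kernel_distinct:
  assumes vs: "distinct vs"
  shows "card (form_kernel M (set vs)) = card (mat_kernel (form_matrix M vs))"
proof -
  let ?n = "length vs" and ?A = "form_matrix M vs" and ?F = "\<lambda>f. vec (length vs) (\<lambda>i. f (vs ! i))"
  have A: "?A \<in> carrier_mat ?n ?n" by (simp add: form_matrix_def)
  have bij: "bij_betw ((!) vs) {..<?n} (set vs)"
    using vs by (rule bij_betw_nth) simp_all
  have row: "(?A *\<^sub>v ?F f) $ i = form_apply M (set vs) f (vs ! i)" if "i < ?n" for f i
  proof -
    have "(?A *\<^sub>v ?F f) $ i = (\<Sum>j<?n. M (vs ! i) (vs ! j) * f (vs ! j))"
      using that by (simp add: form_matrix_def scalar_prod_def lessThan_atLeast0)
    also have "\<dots> = form_apply M (set vs) f (vs ! i)"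
      unfolding form_apply_def by (rule sum.reindex_bij_betw[OF bij, of "\<lambda>y. M (vs ! i) y * f y"])
    finally show ?thesis .
  qed
  have "bij_betw ?F (form_kernel M (set vs)) (mat_kernel ?A)"
  proof (rule bij_betw_imageI)
    show "inj_on ?F (form_kernel M (set vs))"
    proof (rule inj_onI, rule ext)
      fix f g x assume fg: "f \<in> form_kernel M (set vs)" "g \<in> form_kernel M (set vs)" and eq: "?F f = ?F g"
      show "f x = g x"
      proof (cases "x \<in> set vs")
        case True
        then obtain i where "i < ?n" "x = vs ! i" by (metis in_set_conv_nth)
        with eq show ?thesis by (metis index_vec)
      qed (use fg in \<open>simp add: form_kernel_def\<close>)
    qed
    have "?F f \<in> mat_kernel ?A" if "f \<in> form_kernel M (set vs)" for f
    proof (rule mat_kernelI[OF A])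
      show "?A *\<^sub>v ?F f = 0\<^sub>v ?n"
        using that row A by (intro eq_vecI) (auto simp: form_kernel_def)
    qed simp
    moreover have "v \<in> ?F ` form_kernel M (set vs)" if v: "v \<in> mat_kernel ?A" for v
    proof
      define f where "f x = (if x \<in> set vs then v $ (the_inv_into {..<?n} ((!) vs) x) else 0)" for x
      have dim: "v \<in> carrier_vec ?n" and 0: "?A *\<^sub>v v = 0\<^sub>v ?n"
        using mat_kernelD[OF A v] by auto
      show vF: "v = ?F f"
        using dim the_inv_into_f_f[OF bij_betw_imp_inj_on[OF bij]]
        by (intro eq_vecI) (auto simp: f_def)
      have "form_apply M (set vs) f x = 0" if "x \<in> set vs" for x
      proof -
        from that obtain i where "i < ?n" "x = vs ! i" by (metis in_set_conv_nth)
        then show ?thesis using row[of i f] 0 vF by (metis index_zero_vec(1))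
      qed
      then show "f \<in> form_kernel M (set vs)" by (simp add: form_kernel_def f_def)
    qed
    ultimately show "?F ` form_kernel M (set vs) = mat_kernel ?A" by blast
  qed
  then show ?thesis by (rule bij_betw_same_card)
qed

lemma UNIV_bit: "(UNIV :: bit set) = {0, 1}"
  by (metis (full_types) UNIV_eq_I bit_not_one_iff insertCI)

lemma finite_UNIV_bit: "finite (UNIV :: bit set)"
  by (simp add: UNIV_bit)

lemma card_form_kernel:
  assumes "finite s"
  shows "card (form_kernel M s) = 2 ^ corank M s"
proof -
  define vs where "vs = (SOME vs. distinct vs \<and> set vs = s)"
  have vs: "distinct vs" "set vs = s"
    using someI_ex[of "\<lambda>vs. distinct vs \<and> set vs = s"] finite_distinct_list[OF assms]
    unfolding vs_def by blast+
  have "form_matrix M vs \<in> carrier_mat (length vs) (length vs)" by (simp add: form_matrix_def)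
  then have "card (mat_kernel (form_matrix M vs)) = 2 ^ mat_corank (form_matrix M vs)"
    using card_mat_kernel_eq_power_corank[OF finite_UNIV_bit] by (simp add: UNIV_bit numeral_2_eq_2)
  then show ?thesis
    using card_form_kernel_distinct[OF vs(1), of M] vs(2) by (simp add: corank_def vs_def)
qed

lemma corank_eq_of_bij:
  assumes "finite s" "finite t" "bij_betw F (form_kernel M s) (form_kernel N t)"
  shows "corank M s = corank N t"
  using bij_betw_same_card[OF assms(3)] assms(1,2) by (simp add: card_form_kernel)

lemma corank_cong:
  assumes "finite s" "\<And>x y. x \<in> s \<Longrightarrow> y \<in> s \<Longrightarrow> M x y = N x y"
  shows "corank M s = corank N s"
proof -
  have "form_kernel M s = form_kernel N s" using assms(2) by (auto simp: form_kernel_def form_apply_def)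
  then show ?thesis using assms(1) by (metis card_form_kernel power_inject_exp one_less_numeral_iff semiring_norm(76))
qed

lemma form_apply_superset:
  assumes "finite V" "s \<subseteq> V" "\<And>x. x \<notin> s \<Longrightarrow> f x = 0"
  shows "form_apply M V f x = form_apply M s f x"
  unfolding form_apply_def using assms by (intro sum.mono_neutral_right) auto

text \<open>Seen inside a larger vertex set \<open>V\<close>, membership in the kernel prescribes for each vertex
  \<open>x\<close> that one of the two numbers \<open>f x\<close> and \<open>(M f) x\<close> is zero: the second if \<open>x\<close> belongs to
  the state, the first if it does not. A transformation that interchanges the two numbers at a
  vertex therefore has the same effect as switching the membership of this vertex in the state.\<close>

lemma form_kernel_iff:
  assumes "finite V" "s \<subseteq> V"
  shows "f \<in> form_kernel M s \<longleftrightarrow> (\<forall>x. if x \<in> s then form_apply M V f x = 0 else f x = 0)"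
  using form_apply_superset[OF assms, of f M] by (auto simp: form_kernel_def)

lemma form_apply_remove:
  assumes "finite V" "v \<in> V"
  shows "form_apply M V f x = M x v * f v + form_apply M (V - {v}) f x"
  using assms by (simp add: form_apply_def sum.remove)

lemma form_apply_cong:
  assumes "\<And>y. y \<in> V \<Longrightarrow> M x y = N x y" "\<And>y. y \<in> V \<Longrightarrow> f y = g y"
  shows "form_apply M V f x = form_apply N V g x"
  using assms by (simp add: form_apply_def)

section \<open>Principal pivot transforms\<close>

text \<open>The effect on the adjacency matrix of a local complementation at \<open>v\<close> together with the change
  of the framings of the neighbours of \<open>v\<close>: up to signs, which do not exist here, it is the
  principal pivot transform at \<open>v\<close> when \<open>M v v = 1\<close>.\<close>

definition lc_form :: "('v \<Rightarrow> 'v \<Rightarrow> bit) \<Rightarrow> 'v \<Rightarrow> 'v \<Rightarrow> 'v \<Rightarrow> bit" where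
  "lc_form M v x y = (if x = v \<or> y = v then M x y else M x y + M x v * M v y)"

lemma lc_form_lc_form: "lc_form (lc_form M v) v = M"
  by (auto simp: lc_form_def fun_eq_iff)

text \<open>Passing from \<open>M\<close> to \<open>lc_form M v\<close> interchanges \<open>f v\<close> with \<open>(M f) v\<close> and keeps \<open>f x\<close> and
  \<open>(M f) x\<close> for every other \<open>x\<close>. The reason: as \<open>M v v = 1\<close>, row \<open>v\<close> can be solved for \<open>f v\<close>,
  and substituting the solution into row \<open>x\<close> adds \<open>M x v\<close> times row \<open>v\<close> to it.\<close>

lemma form_apply_lc_form:
  fixes f v V M
  defines "g \<equiv> f(v := form_apply M V f v)"
  assumes V: "finite V" "v \<in> V" and "M v v = 1"
  shows "form_apply (lc_form M v) V g v = f v" (is ?a)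
    and "x \<noteq> v \<Longrightarrow> form_apply (lc_form M v) V g x = form_apply M V f x" (is "_ \<Longrightarrow> ?b")
proof -
  have r: "form_apply M (V - {v}) f v = form_apply M V f v + f v"
    using form_apply_remove[OF V, of M f v] assms(4) by (simp add: ac_simps)
  have "form_apply (lc_form M v) (V - {v}) g v = form_apply M (V - {v}) f v"
    by (rule form_apply_cong) (auto simp: g_def lc_form_def)
  then show ?a
    using form_apply_remove[OF V, of "lc_form M v" g v] assms(4) by (simp add: g_def lc_form_def r)
  show ?b if "x \<noteq> v"
  proof -
    have "form_apply (lc_form M v) (V - {v}) g x = form_apply M (V - {v}) f x + M x v * form_apply M (V - {v}) f v"
      using that unfolding form_apply_def sum_distrib_left sum.distrib[symmetric]
      by (intro sum.cong) (auto simp: g_def lc_form_def algebra_simps)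
    then have "form_apply (lc_form M v) V g x =
        M x v * form_apply M V f v + (form_apply M (V - {v}) f x + M x v * (form_apply M V f v + f v))"
      using form_apply_remove[OF V, of "lc_form M v" g x] that by (simp add: g_def lc_form_def r)
    also have "\<dots> = form_apply M V f x"
      using form_apply_remove[OF V, of M f x] by (simp add: algebra_simps)
    finally show ?thesis .
  qed
qed

text \<open>The interchange of \<open>f v\<close> and \<open>(M f) v\<close> is an involution that carries the kernel for the state
  \<open>s\<close> to the kernel for the state that differs from \<open>s\<close> in \<open>v\<close>.\<close>

lemma corank_lc_form:
  assumes s: "finite s" and "M v v = 1"
  shows "corank (lc_form M v) (sym_diff s {v}) = corank M s"
proof -
  define V where "V = insert v s"
  define F where "F N f = f(v := form_apply N V f v)" for N f
  have V: "finite V" "v \<in> V" using s by (auto simp: V_def)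
  have F: "F N f \<in> form_kernel (lc_form N v) (sym_diff t {v})" "F (lc_form N v) (F N f) = f"
    if "N v v = 1" "t \<subseteq> V" "f \<in> form_kernel N t" for N t f
  proof -
    have "sym_diff t {v} \<subseteq> V" using that(2) V by auto
    moreover have "\<forall>x. if x \<in> t then form_apply N V f x = 0 else f x = 0"
      using that(3) form_kernel_iff[OF V(1) that(2)] by blast
    ultimately show "F N f \<in> form_kernel (lc_form N v) (sym_diff t {v})"
      using form_apply_lc_form[where f = f and M = N, OF V that(1)] by (auto simp: form_kernel_iff[OF V(1)] F_def)
    show "F (lc_form N v) (F N f) = f"
      using form_apply_lc_form(1)[where f = f and M = N, OF V that(1)] by (auto simp: F_def)
  qed
  have s': "s \<subseteq> V" "sym_diff s {v} \<subseteq> V" "sym_diff (sym_diff s {v}) {v} = s" "lc_form M v v v = 1"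
    using assms(2) by (auto simp: V_def lc_form_def)
  have "bij_betw (F M) (form_kernel M s) (form_kernel (lc_form M v) (sym_diff s {v}))"
    using F[where N = M, OF assms(2) s'(1)] F[where N = "lc_form M v", OF s'(4) s'(2), unfolded s'(3) lc_form_lc_form]
    by (intro bij_betwI[where g = "F (lc_form M v)"]) auto
  then show ?thesis using s by (intro corank_eq_of_bij[symmetric]) auto
qed

text \<open>The principal pivot transform at the block of \<open>u\<close> and \<open>v\<close> would also exchange the rows of \<open>u\<close>
  and \<open>v\<close>. The graph operation leaves the neighbours of \<open>u\<close> and \<open>v\<close> alone, so that here the
  names \<open>u\<close> and \<open>v\<close> are exchanged compared with that transform.\<close>

definition pivot_form :: "('v \<Rightarrow> 'v \<Rightarrow> bit) \<Rightarrow> 'v \<Rightarrow> 'v \<Rightarrow> 'v \<Rightarrow> 'v \<Rightarrow> bit" where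
  "pivot_form M u v x y =
    (if x \<in> {u, v} \<or> y \<in> {u, v} then M x y else M x y + (M x u * M v y + M x v * M u y))"

text \<open>Because of this exchange of names the membership of \<open>u\<close> is the negated membership of \<open>v\<close>, and
  vice versa: the states \<open>{}\<close> and \<open>{u, v}\<close> are interchanged, while \<open>{u}\<close> and \<open>{v}\<close> are fixed.\<close>

definition pivot_state :: "'v \<Rightarrow> 'v \<Rightarrow> 'v set \<Rightarrow> 'v set" where
  "pivot_state u v s = {x. if x = u then v \<notin> s else if x = v then u \<notin> s else x \<in> s}"

lemma pivot_form_pivot_form: "pivot_form (pivot_form M u v) u v = M"
  by (auto simp: pivot_form_def fun_eq_iff)

text \<open>The pair \<open>f u\<close>, \<open>f v\<close> is interchanged with the pair \<open>(M f) v\<close>, \<open>(M f) u\<close>: the rows of \<open>u\<close> and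
  \<open>v\<close> can be solved for \<open>f v\<close> and \<open>f u\<close>, respectively, and the solutions substituted into the
  remaining rows.\<close>

lemma form_apply_pivot_form:
  fixes f u v V M
  defines "g \<equiv> f(u := form_apply M V f v, v := form_apply M V f u)"
  assumes V: "finite V" "u \<in> V" "v \<in> V" "u \<noteq> v"
    and M: "M u u = 0" "M v v = 0" "M u v = 1" "M v u = 1"
  shows "form_apply (pivot_form M u v) V g u = f v" (is ?u)
    and "form_apply (pivot_form M u v) V g v = f u" (is ?v)
    and "x \<noteq> u \<Longrightarrow> x \<noteq> v \<Longrightarrow> form_apply (pivot_form M u v) V g x = form_apply M V f x" (is "_ \<Longrightarrow> _ \<Longrightarrow> ?x")
proof -
  let ?R = "V - {u} - {v}" and ?P = "pivot_form M u v"
  have rem: "form_apply N V h x = N x u * h u + (N x v * h v + form_apply N ?R h x)" for N h x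
    using V form_apply_remove[OF V(1,2), of N h x] form_apply_remove[of "V - {u}" v N h x] by simp
  have ru: "form_apply M ?R f u = form_apply M V f u + f v" and rv: "form_apply M ?R f v = form_apply M V f v + f u"
    using rem[of M f u] rem[of M f v] M by (simp_all add: ac_simps)
  have "form_apply ?P ?R g u = form_apply M ?R f u" "form_apply ?P ?R g v = form_apply M ?R f v"
    by (rule form_apply_cong; auto simp: g_def pivot_form_def)+
  then show ?u ?v
    using rem[of ?P g u] rem[of ?P g v] M V(4) by (simp_all add: g_def pivot_form_def ru rv)
  show ?x if "x \<noteq> u" "x \<noteq> v"
  proof -
    have "form_apply ?P ?R g x = form_apply M ?R f x + (M x u * form_apply M ?R f v + M x v * form_apply M ?R f u)"
      using that unfolding form_apply_def sum_distrib_left sum.distrib[symmetric]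
      by (intro sum.cong) (auto simp: g_def pivot_form_def algebra_simps)
    then have "form_apply ?P V g x = M x u * form_apply M V f v + (M x v * form_apply M V f u + (form_apply M ?R f x +
        (M x u * (form_apply M V f v + f u) + M x v * (form_apply M V f u + f v))))"
      using rem[of ?P g x] that V(4) by (simp add: g_def pivot_form_def ru rv)
    also have "\<dots> = form_apply M V f x"
      using rem[of M f x] by (simp add: algebra_simps)
    finally show ?thesis .
  qed
qed

lemma corank_pivot_form:
  assumes s: "finite s" and "u \<noteq> v"
    and M: "M u u = 0" "M v v = 0" "M u v = 1" "M v u = 1"
  shows "corank (pivot_form M u v) (pivot_state u v s) = corank M s"
proof -
  define V where "V = insert u (insert v s)"
  define F where "F N f = f(u := form_apply N V f v, v := form_apply N V f u)" for N f
  have V: "finite V" "u \<in> V" "v \<in> V" "u \<noteq> v" using s assms(2) by (auto simp: V_def)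
  have F: "F N f \<in> form_kernel (pivot_form N u v) (pivot_state u v t)" "F (pivot_form N u v) (F N f) = f"
    if N: "N u u = 0" "N v v = 0" "N u v = 1" "N v u = 1" and "t \<subseteq> V" "f \<in> form_kernel N t" for N t f
  proof -
    have "pivot_state u v t \<subseteq> V" using that(5) V by (auto simp: pivot_state_def split: if_splits)
    moreover have "\<forall>x. if x \<in> t then form_apply N V f x = 0 else f x = 0"
      using that(6) form_kernel_iff[OF V(1) that(5)] by blast
    ultimately show "F N f \<in> form_kernel (pivot_form N u v) (pivot_state u v t)"
      using form_apply_pivot_form[where f = f and M = N, OF V N] V(4)
      by (auto simp: form_kernel_iff[OF V(1)] F_def pivot_state_def)
    show "F (pivot_form N u v) (F N f) = f"
      using form_apply_pivot_form(1,2)[where f = f and M = N, OF V N] by (auto simp: F_def)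
  qed
  let ?P = "pivot_form M u v"
  have s': "s \<subseteq> V" "pivot_state u v s \<subseteq> V" "pivot_state u v (pivot_state u v s) = s"
    using V by (auto simp: V_def pivot_state_def split: if_splits)
  have P: "?P u u = 0" "?P v v = 0" "?P u v = 1" "?P v u = 1"
    using M by (auto simp: pivot_form_def)
  have "bij_betw (F M) (form_kernel M s) (form_kernel ?P (pivot_state u v s))"
    using F[where N = M, OF M s'(1)] F[where N = ?P, OF P s'(2), unfolded s'(3) pivot_form_pivot_form]
    by (intro bij_betwI[where g = "F ?P"]) auto
  then show ?thesis using s finite_subset[OF s'(2) V(1)] by (intro corank_eq_of_bij[symmetric]) auto
qed

section \<open>Dependent vertices and renaming\<close>

text \<open>If some kernel vector \<open>z\<close> does not vanish at \<open>u\<close>, then adding multiples of \<open>z\<close> makes any kernel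
  vector vanish at \<open>u\<close>, and what remains lies in the kernel for the state without \<open>u\<close>.
  Conversely \<open>z\<close> expresses column \<open>u\<close> through the other columns, hence by symmetry row \<open>u\<close>
  through the other rows, so that row \<open>u\<close> imposes no new condition. This one fact covers
  isolated vertices, twins and the dependent vertex of the third move.\<close>

lemma corank_insert_of_form_kernel:
  assumes s: "finite s" "u \<notin> s"
    and sym: "\<And>x y. M x y = M y x"
    and z: "z \<in> form_kernel M (insert u s)" "z u = 1"
  shows "corank M (insert u s) = Suc (corank M s)"
proof -
  let ?V = "insert u s"
  have V: "finite ?V" "s \<subseteq> ?V" "?V \<subseteq> ?V" using s by auto
  have row: "form_apply M ?V f u = 0" if f: "f \<in> form_kernel M s" for f
  proof -
    (* pairing M f with z is pairing f with M z = 0, and the rows other than u contribute nothing *)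
    have "(\<Sum>x\<in>?V. z x * form_apply M ?V f x) = (\<Sum>x\<in>?V. \<Sum>y\<in>?V. z x * (M x y * f y))"
      by (simp add: form_apply_def sum_distrib_left)
    also have "\<dots> = (\<Sum>y\<in>?V. \<Sum>x\<in>?V. z x * (M x y * f y))"
      by (rule sum.swap)
    also have "\<dots> = (\<Sum>y\<in>?V. f y * form_apply M ?V z y)"
      unfolding form_apply_def sum_distrib_left using sym by (intro sum.cong refl) (simp add: ac_simps)
    also have "\<dots> = 0"
      using z(1) by (intro sum.neutral) (auto simp: form_kernel_def)
    finally have "(\<Sum>x\<in>?V. z x * form_apply M ?V f x) = 0" .
    moreover have "(\<Sum>x\<in>s. z x * form_apply M ?V f x) = 0"
      using f by (intro sum.neutral) (auto simp: form_kernel_iff[OF V(1,2)])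
    ultimately show ?thesis using s z(2) by simp
  qed
  have add: "form_apply M ?V (\<lambda>y. f y + b * z y) x = form_apply M ?V f x + b * form_apply M ?V z x" for f b x
    unfolding form_apply_def sum_distrib_left sum.distrib[symmetric]
    by (intro sum.cong refl) (simp add: algebra_simps)
  have z': "form_apply M ?V z x = 0" if "x \<in> ?V" for x using z(1) that by (auto simp: form_kernel_def)
  have "bij_betw (\<lambda>(f, b) y. f y + b * z y) (form_kernel M s \<times> UNIV) (form_kernel M ?V)"
  proof (rule bij_betwI[where g = "\<lambda>f. (\<lambda>y. f y + f u * z y, f u)"])
    show "(\<lambda>(f, b) y. f y + b * z y) \<in> form_kernel M s \<times> UNIV \<rightarrow> form_kernel M ?V"
    proof clarify
      fix f b assume f: "f \<in> form_kernel M s"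
      have "form_apply M ?V (\<lambda>y. f y + b * z y) x = 0" if "x \<in> ?V" for x
        using that row[OF f] f s by (cases "x = u") (auto simp: add z' form_kernel_iff[OF V(1,2)])
      moreover have "f x + b * z x = 0" if "x \<notin> ?V" for x
        using that f z(1) by (auto simp: form_kernel_def)
      ultimately show "(\<lambda>y. f y + b * z y) \<in> form_kernel M ?V" by (auto simp: form_kernel_def)
    qed
    show "(\<lambda>f. (\<lambda>y. f y + f u * z y, f u)) \<in> form_kernel M ?V \<rightarrow> form_kernel M s \<times> UNIV"
    proof
      fix f assume f: "f \<in> form_kernel M ?V"
      have "form_apply M ?V (\<lambda>y. f y + f u * z y) x = 0" if "x \<in> s" for x
        using that f by (auto simp: add z' form_kernel_def)
      moreover have "f x + f u * z x = 0" if "x \<notin> s" for x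
        using that f z by (cases "x = u") (auto simp: form_kernel_def)
      ultimately show "(\<lambda>y. f y + f u * z y, f u) \<in> form_kernel M s \<times> UNIV"
        by (auto simp: form_kernel_iff[OF V(1,2)])
    qed
    show "(\<lambda>f. (\<lambda>y. f y + f u * z y, f u)) (case p of (f, b) \<Rightarrow> \<lambda>y. f y + b * z y) = p"
      if "p \<in> form_kernel M s \<times> UNIV" for p
      using that s z(2) by (auto simp: form_kernel_def algebra_simps)
    show "(case (\<lambda>y. f y + f u * z y, f u) of (f, b) \<Rightarrow> \<lambda>y. f y + b * z y) = f" for f
      by (simp add: algebra_simps)
  qed
  then have "card (form_kernel M ?V) = card (form_kernel M s) * 2"
    by (simp add: bij_betw_same_card[symmetric] card_cartesian_product UNIV_bit numeral_2_eq_2)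
  then have "(2::nat) ^ corank M ?V = 2 ^ Suc (corank M s)"
    using s by (simp add: card_form_kernel)
  then show ?thesis by (metis power_inject_exp one_less_numeral_iff semiring_norm(76))
qed

text \<open>The corank does not depend on the names of the vertices. In the third move this identifies the
  vertex that arises by merging \<open>v\<close> and \<open>w\<close> with the vertex \<open>u\<close> of the other side.\<close>

lemma corank_transpose:
  assumes "finite s"
  shows "corank (\<lambda>x y. M (transpose u v x) (transpose u v y)) (transpose u v ` s) = corank M s"
proof -
  let ?t = "transpose u v"
  have form_apply: "form_apply (\<lambda>x y. N (?t x) (?t y)) (?t ` S) (f \<circ> ?t) (?t x) = form_apply N S f x" for N S f x
    unfolding form_apply_def by (subst sum.reindex) simp_all
  have F: "f \<circ> ?t \<in> form_kernel (\<lambda>x y. N (?t x) (?t y)) (?t ` S)" if "f \<in> form_kernel N S" for f N S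
  proof -
    have "f (?t x) = 0" if "x \<notin> ?t ` S" for x
    proof -
      have "?t x \<notin> S" using that by (metis image_eqI transpose_involutory)
      then show ?thesis using \<open>f \<in> form_kernel N S\<close> by (simp add: form_kernel_def)
    qed
    then show ?thesis using that form_apply[of N S f] by (auto simp: form_kernel_def)
  qed
  have "?t ` ?t ` s = s" by (simp add: image_image)
  then have "bij_betw (\<lambda>f. f \<circ> ?t) (form_kernel M s) (form_kernel (\<lambda>x y. M (?t x) (?t y)) (?t ` s))"
    using F[of _ M s] F[of _ "\<lambda>x y. M (?t x) (?t y)" "?t ` s"]
    by (intro bij_betwI[where g = "\<lambda>f. f \<circ> ?t"]) (auto simp: comp_def)
  then show ?thesis using assms by (intro corank_eq_of_bij[symmetric]) auto
qed

section \<open>State sums\<close>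

text \<open>The exponent \<open>\<alpha>(s) - \<beta>(s)\<close> is a sum of contributions 1 and -1 of the single vertices, where
  the vertices of sign \<open>-\<close> in \<open>s\<close> and the vertices of sign \<open>+\<close> outside of \<open>s\<close> contribute 1.
  Hence the power of \<open>a\<close> is a product of vertex weights.\<close>

definition vertex_weight :: "vsign \<Rightarrow> bool \<Rightarrow> laurent_poly" where
  "vertex_weight \<alpha> b = a_pow (if (\<alpha> = Minus) = b then 1 else - 1)"

definition loop_value :: laurent_poly where "loop_value = - a_pow 2 - a_pow (-2)"

text \<open>The coefficients \<open>F\<close> are arbitrary, so that vertices can be summed out one after the other.\<close>

definition state_sum :: "('v \<Rightarrow> vsign) \<Rightarrow> 'v set \<Rightarrow> ('v set \<Rightarrow> laurent_poly) \<Rightarrow> laurent_poly" where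
  "state_sum \<sigma> V F = (\<Sum>s\<in>Pow V. (\<Prod>x\<in>V. vertex_weight (\<sigma> x) (x \<in> s)) * F s)"

definition bracket :: "'v set \<Rightarrow> ('v \<Rightarrow> 'v \<Rightarrow> bit) \<Rightarrow> ('v \<Rightarrow> vsign) \<Rightarrow> laurent_poly" where
  "bracket V M \<sigma> = state_sum \<sigma> V (\<lambda>s. loop_value ^ corank M s)"

lemma a_pow_mult: "a_pow k * a_pow l = a_pow (k + l)"
  by (simp add: a_pow_def Poly_Mapping.mult_single)

lemma a_pow_0: "a_pow 0 = 1"
  by (simp add: a_pow_def)

lemma a_pow_sum: "finite V \<Longrightarrow> a_pow (\<Sum>x\<in>V. f x) = (\<Prod>x\<in>V. a_pow (f x))"
  by (induction V rule: finite_induct) (simp_all add: a_pow_0 a_pow_mult[symmetric])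

lemma vertex_weight_flip_sign [simp]: "vertex_weight (flip_sign \<alpha>) b = vertex_weight \<alpha> (\<not> b)"
  by (cases \<alpha>) (auto simp: vertex_weight_def)

lemma state_sum_cong:
  assumes "\<And>x. x \<in> V \<Longrightarrow> \<sigma> x = \<tau> x" and "\<And>s. s \<subseteq> V \<Longrightarrow> F s = F' s"
  shows "state_sum \<sigma> V F = state_sum \<tau> V F'"
  unfolding state_sum_def using assms by (intro sum.cong) auto

text \<open>A state either avoids \<open>u\<close> or arises by adding \<open>u\<close> to one that does; the other vertices have
  the same weights in both.\<close>

lemma state_sum_insert:
  assumes V: "finite V" "u \<notin> V"
  shows "state_sum \<sigma> (insert u V) F =
    state_sum \<sigma> V (\<lambda>s. vertex_weight (\<sigma> u) False * F s + vertex_weight (\<sigma> u) True * F (insert u s))"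
proof -
  let ?w = "\<lambda>W s. \<Prod>x\<in>W. vertex_weight (\<sigma> x) (x \<in> s)"
  have w: "?w (insert u V) s = vertex_weight (\<sigma> u) False * ?w V s"
      "?w (insert u V) (insert u s) = vertex_weight (\<sigma> u) True * ?w V s" if "s \<in> Pow V" for s
  proof -
    have "?w V (insert u s) = ?w V s"
      using V by (intro prod.cong refl arg_cong[where f = "vertex_weight _"]) auto
    then show "?w (insert u V) (insert u s) = vertex_weight (\<sigma> u) True * ?w V s" using V by simp
    have "u \<notin> s" using that V by auto
    then show "?w (insert u V) s = vertex_weight (\<sigma> u) False * ?w V s" using V by simp
  qed
  have "inj_on (insert u) (Pow V)" using V by (auto intro!: inj_onI)
  then have "state_sum \<sigma> (insert u V) F =
      (\<Sum>s\<in>Pow V. ?w (insert u V) s * F s) + (\<Sum>s\<in>Pow V. ?w (insert u V) (insert u s) * F (insert u s))"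
    unfolding state_sum_def Pow_insert using V
    by (subst sum.union_disjoint) (auto simp: sum.reindex)
  also have "\<dots> = state_sum \<sigma> V (\<lambda>s. vertex_weight (\<sigma> u) False * F s + vertex_weight (\<sigma> u) True * F (insert u s))"
    unfolding state_sum_def sum.distrib[symmetric]
    by (intro sum.cong refl) (simp only: w, simp only: algebra_simps)
  finally show ?thesis .
qed

lemma state_sum_scale: "state_sum \<sigma> V (\<lambda>s. c * F s) = c * state_sum \<sigma> V F"
  by (simp add: state_sum_def sum_distrib_left ac_simps)

lemma bracket_cong:
  assumes "finite V" "\<And>x y. x \<in> V \<Longrightarrow> y \<in> V \<Longrightarrow> M x y = N x y" "\<And>x. x \<in> V \<Longrightarrow> \<sigma> x = \<tau> x"
  shows "bracket V M \<sigma> = bracket V N \<tau>"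
proof -
  have "corank M s = corank N s" if "s \<subseteq> V" for s
    using assms(1,2) that by (intro corank_cong) (auto intro: finite_subset)
  then show ?thesis unfolding bracket_def using assms(3) by (intro state_sum_cong) auto
qed

lemma state_sum_reindex:
  assumes h: "\<And>s. s \<subseteq> V \<Longrightarrow> h s \<subseteq> V \<and> h (h s) = s"
    and w: "\<And>s. s \<subseteq> V \<Longrightarrow> (\<Prod>x\<in>V. vertex_weight (\<tau> x) (x \<in> h s)) = (\<Prod>x\<in>V. vertex_weight (\<sigma> x) (x \<in> s))"
    and F: "\<And>s. s \<subseteq> V \<Longrightarrow> F' (h s) = F s"
  shows "state_sum \<tau> V F' = state_sum \<sigma> V F"
  unfolding state_sum_def
proof (rule sum.reindex_bij_witness[where i = h and j = h])
  fix s assume s: "s \<in> Pow V"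
  then have "h s \<subseteq> V" "h (h s) = s" using h by auto
  then show "(\<Prod>x\<in>V. vertex_weight (\<sigma> x) (x \<in> h s)) * F (h s) = (\<Prod>x\<in>V. vertex_weight (\<tau> x) (x \<in> s)) * F' s"
    using w[of "h s"] F[of "h s"] by simp
qed (use h in auto)

section \<open>Invariance of the bracket on the level of matrices\<close>

text \<open>Switching \<open>v\<close> in every state is a bijection of the states. It preserves the coranks by
  \<open>corank_lc_form\<close>, and the weights because the sign of \<open>v\<close> is changed.\<close>

lemma bracket_lc_form:
  assumes V: "finite V" "v \<in> V" and "M v v = 1"
  shows "bracket V (lc_form M v) (\<sigma>(v := flip_sign (\<sigma> v))) = bracket V M \<sigma>"
  unfolding bracket_def
proof (rule state_sum_reindex[where h = "\<lambda>s. sym_diff s {v}"])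
  fix s assume s: "s \<subseteq> V"
  show "sym_diff s {v} \<subseteq> V \<and> sym_diff (sym_diff s {v}) {v} = s" using s V by auto
  show "(\<Prod>x\<in>V. vertex_weight ((\<sigma>(v := flip_sign (\<sigma> v))) x) (x \<in> sym_diff s {v})) = (\<Prod>x\<in>V. vertex_weight (\<sigma> x) (x \<in> s))"
    by (intro prod.cong) auto
  show "loop_value ^ corank (lc_form M v) (sym_diff s {v}) = loop_value ^ corank M s"
    using corank_lc_form[of s M v] finite_subset[OF s V(1)] assms(3) by simp
qed

text \<open>The same with \<open>pivot_state\<close>. Its exchange of \<open>u\<close> and \<open>v\<close> is the reason why the two signs are
  not only changed but also exchanged.\<close>

lemma bracket_pivot_form:
  assumes V: "finite V" "u \<in> V" "v \<in> V" "u \<noteq> v"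
    and M: "M u u = 0" "M v v = 0" "M u v = 1" "M v u = 1"
  shows "bracket V (pivot_form M u v) (\<sigma>(u := flip_sign (\<sigma> v), v := flip_sign (\<sigma> u))) = bracket V M \<sigma>"
  unfolding bracket_def
proof (rule state_sum_reindex[where h = "pivot_state u v"])
  let ?\<tau> = "\<sigma>(u := flip_sign (\<sigma> v), v := flip_sign (\<sigma> u))"
  fix s assume s: "s \<subseteq> V"
  show "pivot_state u v s \<subseteq> V \<and> pivot_state u v (pivot_state u v s) = s"
    using s V by (auto simp: pivot_state_def split: if_splits)
  have split: "(\<Prod>x\<in>V. f x) = f u * (f v * (\<Prod>x\<in>V - {u} - {v}. f x))" for f :: "'a \<Rightarrow> laurent_poly"
    using V by (simp add: prod.remove)
  have "(\<Prod>x\<in>V - {u} - {v}. vertex_weight (?\<tau> x) (x \<in> pivot_state u v s)) = (\<Prod>x\<in>V - {u} - {v}. vertex_weight (\<sigma> x) (x \<in> s))"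
    by (intro prod.cong) (auto simp: pivot_state_def)
  then show "(\<Prod>x\<in>V. vertex_weight (?\<tau> x) (x \<in> pivot_state u v s)) = (\<Prod>x\<in>V. vertex_weight (\<sigma> x) (x \<in> s))"
    unfolding split using V(4) by (simp add: pivot_state_def ac_simps)
  show "loop_value ^ corank (pivot_form M u v) (pivot_state u v s) = loop_value ^ corank M s"
    using corank_pivot_form[of s u v M] finite_subset[OF s V(1)] V(4) M by simp
qed

lemma unit_in_form_kernel_iff:
  assumes "finite s" "u \<in> s"
  shows "(\<lambda>y. of_bool (y = u)) \<in> form_kernel M s \<longleftrightarrow> (\<forall>x\<in>s. M x u = 0)"
  using assms by (auto simp: form_kernel_def form_apply_def)

text \<open>With an isolated unframed vertex the corank grows by one, so that this vertex contributes the factor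
  \<open>a\<^sup>-\<^sup>1 + a (- a\<^sup>2 - a\<^sup>-\<^sup>2) = - a\<^sup>3\<close> or, for the other sign, the same with \<open>a\<close> inverted.\<close>

lemma bracket_insert_isolated:
  assumes V: "finite V" "v \<notin> V" and sym: "\<And>x y. M x y = M y x"
    and M: "\<And>x. x \<in> insert v V \<Longrightarrow> M v x = 0"
  shows "bracket (insert v V) M \<sigma> = - a_pow (if \<sigma> v = Minus then 3 else - 3) * bracket V M \<sigma>"
proof -
  have M0: "M x v = 0" if "x \<in> insert v V" for x using M[OF that] sym by metis
  have c: "corank M (insert v s) = Suc (corank M s)" if "s \<subseteq> V" for s
  proof (rule corank_insert_of_form_kernel[where z = "\<lambda>y. of_bool (y = v)"])
    show "finite s" "v \<notin> s" using that V finite_subset by auto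
    then show "(\<lambda>y. of_bool (y = v)) \<in> form_kernel M (insert v s)"
      using M0 that by (subst unit_in_form_kernel_iff) auto
  qed (auto simp: sym)
  have w: "vertex_weight (\<sigma> v) False + vertex_weight (\<sigma> v) True * loop_value = - a_pow (if \<sigma> v = Minus then 3 else - 3)"
    by (simp add: vertex_weight_def loop_value_def right_diff_distrib a_pow_mult)
  have "bracket (insert v V) M \<sigma> =
      state_sum \<sigma> V (\<lambda>s. (vertex_weight (\<sigma> v) False + vertex_weight (\<sigma> v) True * loop_value) * loop_value ^ corank M s)"
    unfolding bracket_def state_sum_insert[OF V]
    by (intro state_sum_cong) (simp_all add: c algebra_simps)
  then show ?thesis unfolding w state_sum_scale bracket_def .
qed

text \<open>The identity behind the second move, with \<open>p = a\<close> and \<open>q = a\<^sup>-\<^sup>1\<close>: the states that contain a twin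
  have total coefficient \<open>p\<^sup>2 + q\<^sup>2 + d = 0\<close>.\<close>

lemma twin_states_cancel:
  fixes p q A B d :: "'a::comm_ring_1"
  assumes "p * q = 1" and "d = - (p * p) - q * q"
  shows "q * (p * A + q * B) + p * (p * B + q * (d * B)) = A"
proof -
  have pq: "p * (q * x) = x" for x using assms(1) by (simp flip: mult.assoc)
  show ?thesis by (simp add: assms algebra_simps pq)
qed

text \<open>The identity behind the third move. Here \<open>A\<close>, \<open>B\<close>, \<open>C\<close>, \<open>D\<close> are the values of a state without
  \<open>u\<close> according to its trace \<open>{}\<close>, \<open>{v}\<close>, \<open>{w}\<close>, \<open>{v, w}\<close>, and \<open>E\<close> is the value when \<open>u\<close> is present
  without \<open>v\<close> and \<open>w\<close> after the move. Both sides reduce to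
  \<open>p A + q B + q C + p D + p\<^sup>3 E\<close>.\<close>

lemma third_move_states:
  fixes p q A B C D E d :: "'a::comm_ring_1"
  assumes "p * q = 1" and "d = - (p * p) - q * q"
  shows "p * (p * (q * A + p * E) + q * (q * B + p * D)) + q * (p * (q * C + p * D) + q * (q * D + p * (d * D))) =
    q * (q * (q * A + p * (d * A)) + p * (q * B + p * A)) + p * (q * (q * C + p * A) + p * (q * D + p * E))"
proof -
  have pq: "p * (q * x) = x" for x using assms(1) by (simp flip: mult.assoc)
  show ?thesis by (simp add: assms algebra_simps pq)
qed

lemma a_pow_inverse: "a_pow 1 * a_pow (- 1) = 1"
  by (simp add: a_pow_mult a_pow_0)

lemma loop_value_eq: "loop_value = - (a_pow 1 * a_pow 1) - a_pow (- 1) * a_pow (- 1)"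
  by (simp add: loop_value_def a_pow_mult)

text \<open>The sum of the unit vectors at \<open>x\<close> and \<open>y\<close> is a kernel vector whenever both twins are present,
  so removing either of them lowers the corank by one.\<close>

lemma bracket_insert_twins:
  assumes V: "finite V" "x \<notin> V" "y \<notin> V" "x \<noteq> y" and sym: "\<And>p q. M p q = M q p"
    and M: "\<And>t. t \<in> insert x (insert y V) \<Longrightarrow> M x t = M y t"
    and \<sigma>: "\<sigma> x = Plus" "\<sigma> y = Minus"
  shows "bracket (insert x (insert y V)) M \<sigma> = bracket V M \<sigma>"
proof -
  have c: "corank M (insert x (insert y s)) = Suc (corank M (insert y s))"
      "corank M (insert x (insert y s)) = Suc (corank M (insert x s))" if s: "s \<subseteq> V" for s
  proof -
    let ?z = "\<lambda>t. of_bool (t = x) + of_bool (t = y) :: bit"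
    let ?S = "insert x (insert y s)"
    have fin: "finite ?S" and mem: "x \<notin> s" "y \<notin> s" using s V finite_subset by auto
    have "form_apply M ?S ?z t = 0" if "t \<in> ?S" for t
    proof -
      have "form_apply M ?S ?z t = M t x + M t y"
        using fin by (simp add: form_apply_def distrib_left sum.distrib)
      moreover have "M t x = M t y" using M[OF _] that s sym by (metis insert_iff subsetD)
      ultimately show ?thesis by simp
    qed
    then have z: "?z \<in> form_kernel M ?S" by (auto simp: form_kernel_def)
    show "corank M ?S = Suc (corank M (insert y s))"
      by (rule corank_insert_of_form_kernel[where z = ?z]) (use fin mem V z sym in auto)
    have "corank M (insert y (insert x s)) = Suc (corank M (insert x s))"
      by (rule corank_insert_of_form_kernel[where z = ?z]) (use fin mem V z sym in \<open>auto simp: insert_commute\<close>)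
    then show "corank M ?S = Suc (corank M (insert x s))" by (simp add: insert_commute)
  qed
  have "bracket (insert x (insert y V)) M \<sigma> = state_sum \<sigma> (insert y V)
      (\<lambda>s. vertex_weight Plus False * loop_value ^ corank M s + vertex_weight Plus True * loop_value ^ corank M (insert x s))"
    unfolding bracket_def using V by (subst state_sum_insert) (simp_all add: \<sigma>)
  also have "\<dots> = state_sum \<sigma> V (\<lambda>s. loop_value ^ corank M s)"
    unfolding state_sum_insert[OF V(1,3)]
  proof (rule state_sum_cong)
    fix s assume s: "s \<subseteq> V"
    have eq: "corank M (insert x s) = corank M (insert y s)" using c[OF s] by simp
    show "vertex_weight (\<sigma> y) False * (vertex_weight Plus False * loop_value ^ corank M s + vertex_weight Plus True * loop_value ^ corank M (insert x s)) +
         vertex_weight (\<sigma> y) True * (vertex_weight Plus False * loop_value ^ corank M (insert y s) +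
           vertex_weight Plus True * loop_value ^ corank M (insert x (insert y s))) =
         loop_value ^ corank M s"
      using twin_states_cancel[OF a_pow_inverse loop_value_eq]
      unfolding c(1)[OF s] eq by (simp add: vertex_weight_def \<sigma>)
  qed simp
  finally show ?thesis by (simp add: bracket_def)
qed

text \<open>The eight traces of a state on \<open>{u, v, w}\<close> are compared one by one. Before the move \<open>u\<close> is
  isolated when neither \<open>v\<close> nor \<open>w\<close> is present, it is a leaf whose edge can be pivoted away when
  one of them is present, and when both are present a pivot at \<open>u\<close> and \<open>v\<close> merges \<open>v\<close> and \<open>w\<close>
  into one vertex whose row is the sum of their rows. After the move \<open>u\<close> itself is such a
  vertex, so the vertices \<open>u\<close>, \<open>v\<close>, \<open>w\<close> are linearly dependent and any two of them give the
  same corank, which grows by one when all three are present.\<close>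

lemma bracket_third_move:
  assumes R: "finite R" "u \<notin> R" "v \<notin> R" "w \<notin> R" "u \<noteq> v" "u \<noteq> w" "v \<noteq> w"
    and symM: "\<And>x y. M x y = M y x" and symN: "\<And>x y. N x y = N y x"
    and M: "M u u = 0" "M v v = 0" "M w w = 0" "M u v = 1" "M u w = 1"
      "\<And>x. x \<in> R \<Longrightarrow> M u x = 0"
    and N: "N u u = 0" "\<And>x. x \<in> insert v (insert w R) \<Longrightarrow> N u x = M v x + M w x"
      "\<And>x y. x \<noteq> u \<Longrightarrow> y \<noteq> u \<Longrightarrow> N x y = M x y"
    and \<sigma>: "\<sigma> u = Minus" "\<sigma> v = Minus" "\<sigma> w = Minus"
  shows "bracket (insert u (insert v (insert w R))) N (\<sigma>(v := Plus, w := Plus)) =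
    bracket (insert u (insert v (insert w R))) M \<sigma>"
proof -
  let ?\<tau> = "\<sigma>(v := Plus, w := Plus)"
  have M': "M v u = 1" "M w u = 1" "\<And>x. x \<in> R \<Longrightarrow> M x u = 0"
    using M(4-6) symM by (metis)+
  have N': "\<And>x. x \<in> insert v (insert w R) \<Longrightarrow> N x u = M v x + M w x"
    using N(2) symN by metis
  have leaf: "corank M (insert u (insert x s)) = corank M s"
    if s: "s \<subseteq> R" and x: "x = v \<or> x = w" for s x
  proof -
    have fin: "finite s" using s R(1) finite_subset by auto
    have "pivot_state u x s = insert u (insert x s)"
      using s x R by (auto simp: pivot_state_def)
    then have "corank (pivot_form M u x) (insert u (insert x s)) = corank M s"
      using corank_pivot_form[of s u x M] fin x R M M' by auto
    moreover have "corank (pivot_form M u x) (insert u (insert x s)) = corank M (insert u (insert x s))"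
      using fin M(6) M'(3) by (intro corank_cong) (auto simp: pivot_form_def dest!: subsetD[OF s])
    ultimately show ?thesis by simp
  qed
  have lone: "corank M (insert u s) = Suc (corank M s)" if s: "s \<subseteq> R" for s
  proof (rule corank_insert_of_form_kernel[where z = "\<lambda>y. of_bool (y = u)"])
    show "finite s" "u \<notin> s" using s R finite_subset by auto
    then show "(\<lambda>y. of_bool (y = u)) \<in> form_kernel M (insert u s)"
      using M M' s by (subst unit_in_form_kernel_iff) auto
  qed (auto simp: symM)
  have full: "corank M (insert u (insert v (insert w s))) = corank N (insert u s)"
    if s: "s \<subseteq> R" for s
  proof -
    (* after the pivot at u and v the vertex w carries the row that u carries in N *)
    let ?P = "pivot_form M u v" and ?t = "Transposition.transpose u w"
    have fin: "finite s" using s R(1) finite_subset by auto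
    have "pivot_state u v (insert u (insert v (insert w s))) = insert w s"
      using s R by (auto simp: pivot_state_def)
    then have "corank M (insert u (insert v (insert w s))) = corank ?P (insert w s)"
      using corank_pivot_form[of "insert u (insert v (insert w s))" u v M] fin R M M' by simp
    also have "\<dots> = corank (\<lambda>x y. ?P (?t x) (?t y)) (?t ` insert w s)"
      using fin by (intro corank_transpose[symmetric]) simp
    also have "?t ` insert w s = insert u s"
    proof -
      have "?t ` s = s" using s R by (intro transpose_image_eq) auto
      then show ?thesis by simp
    qed
    also have "corank (\<lambda>x y. ?P (?t x) (?t y)) (insert u s) = corank N (insert u s)"
    proof (rule corank_cong)
      have t: "?t x = x" if "x \<in> s" for x using that s R by (intro transpose_apply_other) auto
      fix x y assume "x \<in> insert u s" "y \<in> insert u s"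
      then consider "x = u" "y = u" | "x = u" "y \<in> s" | "x \<in> s" "y = u" | "x \<in> s" "y \<in> s" by auto
      then show "?P (?t x) (?t y) = N x y"
      proof cases
        case 1
        then show ?thesis using R M M' N(1) symM[of v w] by (simp add: pivot_form_def)
      next
        case 2
        then have "y \<in> R" "y \<notin> {u, v, w}" using s R by auto
        then show ?thesis using 2 R M M' N(2) by (simp add: pivot_form_def t ac_simps)
      next
        case 3
        then have "x \<in> R" "x \<notin> {u, v, w}" using s R by auto
        then show ?thesis using 3 R M M' N' symM[of x v] symM[of x w] by (simp add: pivot_form_def t ac_simps)
      next
        case 4
        then have "x \<in> R" "y \<in> R" "x \<notin> {u, v, w}" "y \<notin> {u, v, w}" using s R by auto
        then show ?thesis using 4 R M M' N(3) by (simp add: pivot_form_def t)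
      qed
    qed (use fin in simp)
    finally show ?thesis .
  qed
  have eq: "corank N s = corank M s" if "finite s" "u \<notin> s" for s
    using that by (intro corank_cong N(3)) auto
  have dep: "corank N (insert u (insert v (insert w s))) = Suc (corank N (insert v (insert w s)))"
      "corank N (insert u (insert v (insert w s))) = Suc (corank N (insert u (insert w s)))"
      "corank N (insert u (insert v (insert w s))) = Suc (corank N (insert u (insert v s)))"
    if s: "s \<subseteq> R" for s
  proof -
    let ?S = "insert u (insert v (insert w s))"
    (* row u of N is the sum of rows v and w, so the three unit vectors add up to a kernel vector *)
    let ?z = "\<lambda>t. of_bool (t = u) + (of_bool (t = v) + of_bool (t = w)) :: bit"
    have fin: "finite ?S" and mem: "u \<notin> s" "v \<notin> s" "w \<notin> s" using s R finite_subset by auto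
    have "form_apply N ?S ?z t = 0" if t: "t \<in> ?S" for t
    proof -
      have m: "form_apply N ?S ?z t = N t u + (N t v + N t w)"
        using fin by (simp add: form_apply_def distrib_left sum.distrib)
      consider "t = u" | "t = v" | "t = w" | "t \<in> R" "t \<notin> {u, v, w}" using t s R by auto
      then show ?thesis
      proof cases
        case 1
        then show ?thesis unfolding m using M(2,3) N(1) N(2)[of v] N(2)[of w] symM[of v w] by simp
      next
        case 2
        then show ?thesis unfolding m using R M(2) N(3) N'[of v] symM[of v w] by simp
      next
        case 3
        then show ?thesis unfolding m using R M(3) N(3) N'[of w] symM[of v w] by simp
      next
        case 4
        then show ?thesis unfolding m using R N(3) N'[of t] symM[of t v] symM[of t w] by (simp add: ac_simps)
      qed
    qed
    then have z: "?z \<in> form_kernel N ?S" by (auto simp: form_kernel_def)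
    have remove: "corank N ?S = Suc (corank N T)"
      if "?S = insert x T" "x \<notin> T" "?z x = 1" for x T
    proof -
      have "finite T" using fin that(1) by (metis finite_insert)
      then have "corank N (insert x T) = Suc (corank N T)"
        using that(2,3) z[unfolded that(1)] by (intro corank_insert_of_form_kernel[where z = ?z] symN)
      then show ?thesis using that(1) by simp
    qed
    show "corank N ?S = Suc (corank N (insert v (insert w s)))"
      using R mem by (intro remove[of u]) auto
    show "corank N ?S = Suc (corank N (insert u (insert w s)))"
      using R mem by (intro remove[of v]) auto
    show "corank N ?S = Suc (corank N (insert u (insert v s)))"
      using R mem by (intro remove[of w]) auto
  qed
  define T where "T L \<rho> s =
      vertex_weight (\<rho> w) False * (vertex_weight (\<rho> v) False * (vertex_weight (\<rho> u) False * loop_value ^ corank L s +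
            vertex_weight (\<rho> u) True * loop_value ^ corank L (insert u s)) +
          vertex_weight (\<rho> v) True * (vertex_weight (\<rho> u) False * loop_value ^ corank L (insert v s) +
            vertex_weight (\<rho> u) True * loop_value ^ corank L (insert u (insert v s)))) +
      vertex_weight (\<rho> w) True * (vertex_weight (\<rho> v) False * (vertex_weight (\<rho> u) False * loop_value ^ corank L (insert w s) +
            vertex_weight (\<rho> u) True * loop_value ^ corank L (insert u (insert w s))) +
          vertex_weight (\<rho> v) True * (vertex_weight (\<rho> u) False * loop_value ^ corank L (insert v (insert w s)) +
            vertex_weight (\<rho> u) True * loop_value ^ corank L (insert u (insert v (insert w s)))))" for L \<rho> s
  have expand: "bracket (insert u (insert v (insert w R))) L \<rho> = state_sum \<rho> R (T L \<rho>)" for L \<rho>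
    using R by (simp add: bracket_def state_sum_insert T_def[abs_def])
  show ?thesis
    unfolding expand
  proof (rule state_sum_cong)
    fix s assume s: "s \<subseteq> R"
    then have fin: "finite s" and mem: "u \<notin> s" "v \<notin> s" "w \<notin> s" using R finite_subset by auto
    have N_eq: "corank N s = corank M s" "corank N (insert v s) = corank M (insert v s)"
        "corank N (insert w s) = corank M (insert w s)"
        "corank N (insert v (insert w s)) = corank M (insert v (insert w s))"
        "corank N (insert u (insert v s)) = corank M (insert v (insert w s))"
        "corank N (insert u (insert w s)) = corank M (insert v (insert w s))"
        "corank N (insert u (insert v (insert w s))) = Suc (corank M (insert v (insert w s)))"
      using eq fin mem R dep[OF s] by simp_all
    have M_eq: "corank M (insert u s) = Suc (corank M s)"
        "corank M (insert u (insert v s)) = corank M s" "corank M (insert u (insert w s)) = corank M s"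
        "corank M (insert u (insert v (insert w s))) = corank N (insert u s)"
      using lone[OF s] leaf[OF s] full[OF s] by simp_all
    have signs: "vertex_weight (?\<tau> u) = vertex_weight Minus" "vertex_weight (?\<tau> v) = vertex_weight Plus" "vertex_weight (?\<tau> w) = vertex_weight Plus"
      using R \<sigma> by simp_all
    have weights: "vertex_weight Plus True = a_pow (- 1)" "vertex_weight Plus False = a_pow 1"
        "vertex_weight Minus True = a_pow 1" "vertex_weight Minus False = a_pow (- 1)"
      by (simp_all add: vertex_weight_def)
    show "T N ?\<tau> s = T M \<sigma> s"
      unfolding T_def signs \<sigma> weights N_eq M_eq power_Suc
      by (rule third_move_states[OF a_pow_inverse loop_value_eq])
  qed (use R in auto)
qed

section \<open>From labeled graphs to matrices\<close>

definition graph_form :: "'v lgraph \<Rightarrow> 'v \<Rightarrow> 'v \<Rightarrow> bit" where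
  "graph_form G x y = (if x = y then framing G x else of_bool (adjacent G x y))"

lemma lgraph_corank_induced:
  assumes "finite s"
  shows "lgraph_corank (induced G s) = corank (graph_form G) s"
proof -
  define vs where "vs = (SOME vs. distinct vs \<and> set vs = s)"
  have vs: "distinct vs" "set vs = s"
    using someI_ex[of "\<lambda>vs. distinct vs \<and> set vs = s"] finite_distinct_list[OF assms]
    unfolding vs_def by blast+
  have "adjacency_matrix (induced G s) vs = form_matrix (graph_form G) vs"
    using vs by (intro eq_matI)
      (auto simp: adjacency_matrix_def form_matrix_def graph_form_def induced_def nth_eq_iff_index_eq)
  then show ?thesis
    by (simp add: lgraph_corank_def corank_def vs_def induced_def)
qed

text \<open>The vertices counted by \<open>\<alpha>(s)\<close> are exactly those with weight \<open>a\<close>; all others have weight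
  \<open>a\<^sup>-\<^sup>1\<close>.\<close>

lemma a_pow_state_weight:
  assumes V: "finite (verts G)" "s \<subseteq> verts G"
  shows "a_pow (int (state_alpha G s) - int (state_beta G s)) =
    (\<Prod>x\<in>verts G. vertex_weight (vsign G x) (x \<in> s))"
proof -
  let ?c = "\<lambda>x. (vsign G x = Minus) = (x \<in> s)" and ?V = "verts G"
  have "{x \<in> ?V. ?c x} = {x \<in> s. vsign G x = Minus} \<union> {x \<in> ?V - s. vsign G x = Plus}"
    using V(2) vsign.exhaust by auto
  then have \<alpha>: "state_alpha G s = card {x \<in> ?V. ?c x}"
    using V finite_subset[OF V(2,1)] by (subst state_alpha_def, simp only:) (subst card_Un_disjoint; auto)
  have "card ?V = card {x \<in> ?V. ?c x} + card {x \<in> ?V. \<not> ?c x}"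
    using V(1) by (subst card_Un_disjoint[symmetric]) (auto intro!: arg_cong[where f = card])
  then have \<beta>: "state_beta G s = card {x \<in> ?V. \<not> ?c x}"
    by (simp add: state_beta_def \<alpha>)
  have "int (state_alpha G s) - int (state_beta G s) = (\<Sum>x\<in>?V. if ?c x then 1 else - 1)"
    using V(1) unfolding \<alpha> \<beta> by (simp add: sum.If_cases Int_def)
  then show ?thesis
    using V(1) by (simp add: a_pow_sum vertex_weight_def)
qed

lemma kauffman_bracket_eq:
  assumes "finite (verts G)"
  shows "kauffman_bracket G = bracket (verts G) (graph_form G) (vsign G)"
  unfolding kauffman_bracket_def bracket_def state_sum_def loop_value_def
  using assms
  by (intro sum.cong refl) (simp add: a_pow_state_weight lgraph_corank_induced finite_subset)

lemma kauffman_bracket_same: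
  assumes "H \<doteq> K" "finite (verts K)"
  shows "kauffman_bracket H = bracket (verts K) (graph_form K) (vsign K)"
proof -
  have "verts H = verts K" using assms(1) by (simp add: same_lgraph_def)
  moreover have "bracket (verts K) (graph_form H) (vsign H) = bracket (verts K) (graph_form K) (vsign K)"
    using assms by (intro bracket_cong) (auto simp: same_lgraph_def graph_form_def)
  ultimately show ?thesis using assms(2) by (simp add: kauffman_bracket_eq)
qed

lemma kauffman_bracket_induced:
  assumes "H \<doteq> induced G W" "finite W"
  shows "kauffman_bracket H = bracket W (graph_form G) (vsign G)"
proof -
  have "bracket W (graph_form (induced G W)) (vsign (induced G W)) = bracket W (graph_form G) (vsign G)"
    using assms(2) by (intro bracket_cong) (auto simp: graph_form_def induced_def)
  then show ?thesis using kauffman_bracket_same[OF assms(1)] assms(2) by (simp add: induced_def)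
qed

lemma graph_form_sym:
  assumes "labeled_graph G"
  shows "graph_form G x y = graph_form G y x"
  using assms by (auto simp: labeled_graph_def graph_form_def)

lemma mem_nbhd_iff:
  assumes "labeled_graph G"
  shows "x \<in> nbhd G v \<longleftrightarrow> adjacent G v x"
  using assms by (auto simp: labeled_graph_def nbhd_def)

section \<open>The graph-moves\<close>

lemma kauffman_bracket_omega_g1_removal:
  assumes G: "labeled_graph G" and "omega_g1_removal G H"
  shows "kauffman_bracket G = - a_pow 3 * kauffman_bracket H \<or>
    kauffman_bracket G = - a_pow (-3) * kauffman_bracket H"
proof -
  from assms(2) obtain v where v: "v \<in> verts G" "framing G v = 0" "nbhd G v = {}"
      "H \<doteq> induced G (verts G - {v})"
    unfolding omega_g1_removal_def by blast
  have fin: "finite (verts G)" using G by (simp add: labeled_graph_def)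
  have V: "insert v (verts G - {v}) = verts G" using v(1) by auto
  have "graph_form G v x = 0" for x
    using v(2,3) mem_nbhd_iff[OF G, of x v] by (auto simp: graph_form_def)
  then have "kauffman_bracket G = - a_pow (if vsign G v = Minus then 3 else - 3) * kauffman_bracket H"
    using bracket_insert_isolated[of "verts G - {v}" v "graph_form G" "vsign G", unfolded V] fin
    by (simp add: kauffman_bracket_eq kauffman_bracket_induced[OF v(4)] graph_form_sym[OF G])
  then show ?thesis by (simp split: if_splits)
qed

lemma kauffman_bracket_omega_g2_removal:
  assumes G: "labeled_graph G" and "omega_g2_removal G H"
  shows "kauffman_bracket G = kauffman_bracket H"
proof -
  from assms(2) obtain x y where xy: "x \<in> verts G" "y \<in> verts G" "x \<noteq> y"
      and signs: "vsign G x = Plus" "vsign G y = Minus"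
      and labels: "(\<not> adjacent G x y \<and> framing G x = 0 \<and> framing G y = 0) \<or>
         (adjacent G x y \<and> framing G x = 1 \<and> framing G y = 1)"
      and twins: "\<And>t. t \<in> verts G - {x, y} \<Longrightarrow> adjacent G x t = adjacent G y t"
      and H: "H \<doteq> induced G (verts G - {x, y})"
    unfolding omega_g2_removal_def by blast
  have fin: "finite (verts G)" using G by (simp add: labeled_graph_def)
  have V: "insert x (insert y (verts G - {x, y})) = verts G" using xy by auto
  have adj: "adjacent G y x = adjacent G x y" using G by (auto simp: labeled_graph_def)
  have "graph_form G x t = graph_form G y t" if "t \<in> verts G" for t
    using that twins[of t] labels xy(3) adj by (cases "t = x"; cases "t = y") (auto simp: graph_form_def)
  then show ?thesis
    using bracket_insert_twins[of "verts G - {x, y}" x y "graph_form G" "vsign G", unfolded V] fin xy(3) signs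
    by (simp add: kauffman_bracket_eq kauffman_bracket_induced[OF H] graph_form_sym[OF G])
qed

lemma kauffman_bracket_omega_g3_step:
  assumes G: "labeled_graph G" and "omega_g3_step G H"
  shows "kauffman_bracket H = kauffman_bracket G"
proof -
  from assms(2) obtain u v w where uvw: "u \<in> verts G" "v \<in> verts G" "w \<in> verts G"
        "u \<noteq> v" "u \<noteq> w" "v \<noteq> w"
      and labels: "\<And>x. x \<in> {u, v, w} \<Longrightarrow> framing G x = 0 \<and> vsign G x = Minus"
      and nu: "nbhd G u = {v, w}"
      and H: "H \<doteq> (set_nbhd G u ((nbhd G v - nbhd G w) \<union> (nbhd G w - nbhd G v)))
               \<lparr>vsign := (vsign G)(v := Plus, w := Plus)\<rparr>"
    unfolding omega_g3_step_def by blast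
  define K where "K = (set_nbhd G u ((nbhd G v - nbhd G w) \<union> (nbhd G w - nbhd G v)))
               \<lparr>vsign := (vsign G)(v := Plus, w := Plus)\<rparr>"
  define R where "R = verts G - {u, v, w}"
  have fin: "finite (verts G)" using G by (simp add: labeled_graph_def)
  have V: "verts G = insert u (insert v (insert w R))" using uvw by (auto simp: R_def)
  have irrefl: "\<not> adjacent G x x" and adj_sym: "adjacent G x y = adjacent G y x" for x y
    using G by (auto simp: labeled_graph_def)
  have adj_u: "adjacent G u x \<longleftrightarrow> x = v \<or> x = w" for x
    using nu mem_nbhd_iff[OF G, of x u] by auto
  have K_simps: "verts K = verts G" "vsign K = (vsign G)(v := Plus, w := Plus)"
    by (simp_all add: K_def set_nbhd_def)
  have adj_K: "adjacent K x y = (if x = u then adjacent G v y \<noteq> adjacent G w y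
      else if y = u then adjacent G v x \<noteq> adjacent G w x else adjacent G x y)" for x y
    using mem_nbhd_iff[OF G] by (auto simp: K_def set_nbhd_def)
  have framing_K: "framing K x = framing G x" for x by (simp add: K_def set_nbhd_def)
  have form_u: "graph_form G u x = of_bool (x = v \<or> x = w)" for x
    using uvw labels[of u] by (auto simp: graph_form_def adj_u)
  have "bracket (verts G) (graph_form K) ((vsign G)(v := Plus, w := Plus)) =
      bracket (verts G) (graph_form G) (vsign G)"
    unfolding V
  proof (rule bracket_third_move)
    show "finite R" "u \<notin> R" "v \<notin> R" "w \<notin> R" using fin by (auto simp: R_def)
    show "u \<noteq> v" "u \<noteq> w" "v \<noteq> w" by fact+
    show "graph_form G x y = graph_form G y x" for x y by (rule graph_form_sym[OF G])
    show "graph_form K x y = graph_form K y x" for x y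
      using adj_sym[of x y] by (auto simp: graph_form_def adj_K)
    show "graph_form G u u = 0" "graph_form G v v = 0" "graph_form G w w = 0" "graph_form K u u = 0"
      using labels by (auto simp: graph_form_def framing_K)
    show "graph_form G u v = 1" "graph_form G u w = 1" by (simp_all add: form_u)
    show "graph_form G u x = 0" if "x \<in> R" for x using that by (auto simp: form_u R_def)
    show "graph_form K u x = graph_form G v x + graph_form G w x" if "x \<in> insert v (insert w R)" for x
    proof -
      have "x \<noteq> u" using that uvw by (auto simp: R_def)
      moreover have "graph_form G v x = of_bool (adjacent G v x)" "graph_form G w x = of_bool (adjacent G w x)"
        using labels irrefl by (auto simp: graph_form_def)
      ultimately show ?thesis by (auto simp: graph_form_def adj_K)
    qed
    show "graph_form K x y = graph_form G x y" if "x \<noteq> u" "y \<noteq> u" for x y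
      using that by (simp add: graph_form_def adj_K framing_K)
    show "vsign G u = Minus" "vsign G v = Minus" "vsign G w = Minus" using labels by auto
  qed
  then show ?thesis
    using kauffman_bracket_same[OF H[folded K_def]] fin by (simp add: K_simps kauffman_bracket_eq)
qed

text \<open>The pivot toggles a pair \<open>x\<close>, \<open>y\<close> if exactly one of the products \<open>M x u * M v y\<close> and
  \<open>M x v * M u y\<close> is 1, which is addition of both products to \<open>M x y\<close>. For \<open>x = y\<close> the products
  agree, in accordance with the unchanged framings.\<close>

lemma kauffman_bracket_omega_g4:
  assumes G: "labeled_graph G" and "omega_g4 G H"
  shows "kauffman_bracket H = kauffman_bracket G"
proof -
  from assms(2) obtain u v where uv: "u \<in> verts G" "v \<in> verts G" "adjacent G u v"
      and labels: "framing G u = 0" "framing G v = 0"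
      and H: "H \<doteq> (pivot G u v)
               \<lparr>vsign := (vsign G)(u := flip_sign (vsign G v), v := flip_sign (vsign G u))\<rparr>" (is "_ \<doteq> ?K")
    unfolding omega_g4_def by blast
  have fin: "finite (verts G)" using G by (simp add: labeled_graph_def)
  have irrefl: "\<not> adjacent G x x" and adj_sym: "adjacent G x y = adjacent G y x" for x y
    using G by (auto simp: labeled_graph_def)
  have K: "verts ?K = verts G" "vsign ?K = (vsign G)(u := flip_sign (vsign G v), v := flip_sign (vsign G u))"
    by (simp_all add: pivot_def toggle_adjacency_def)
  have "u \<noteq> v" using uv(3) irrefl by auto
  have pair: "pivot_pair G u v x y \<longleftrightarrow> x \<notin> {u, v} \<and> y \<notin> {u, v} \<and>
      adjacent G x u \<and> adjacent G v y \<and> \<not> (adjacent G x v \<and> adjacent G u y)" for x y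
    using adj_sym[of u x] adj_sym[of v x] by (auto simp: pivot_pair_def mem_nbhd_iff[OF G])
  have "graph_form ?K x y = pivot_form (graph_form G) u v x y" for x y
    using adj_sym[of y u] adj_sym[of y v] adj_sym[of x u] adj_sym[of x v]
    by (auto simp: graph_form_def pivot_def toggle_adjacency_def pair pivot_form_def)
  then have "graph_form ?K = pivot_form (graph_form G) u v" by (intro ext)
  moreover have "graph_form G u u = 0" "graph_form G v v = 0" "graph_form G u v = 1" "graph_form G v u = 1"
    using uv(3) adj_sym[of u v] \<open>u \<noteq> v\<close> labels by (auto simp: graph_form_def)
  ultimately show ?thesis
    using kauffman_bracket_same[OF H] fin
      bracket_pivot_form[OF fin uv(1,2) \<open>u \<noteq> v\<close>, of "graph_form G" "vsign G"]
    by (simp add: K kauffman_bracket_eq)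
qed

text \<open>For \<open>x = y\<close> the added product \<open>M x v * M v x\<close> is 1 exactly if \<open>x\<close> is a neighbour of \<open>v\<close>: the
  change of framings is the diagonal part of the same matrix operation.\<close>

lemma kauffman_bracket_omega_g4':
  assumes G: "labeled_graph G" and "omega_g4' G H"
  shows "kauffman_bracket H = kauffman_bracket G"
proof -
  from assms(2) obtain v where v: "v \<in> verts G" "framing G v = 1"
      and H: "H \<doteq> (local_complementation G v)
               \<lparr>vsign := (vsign G)(v := flip_sign (vsign G v)),
                framing := (\<lambda>x. if x \<in> nbhd G v then framing G x + 1 else framing G x)\<rparr>" (is "_ \<doteq> ?K")
    unfolding omega_g4'_def by blast
  have fin: "finite (verts G)" using G by (simp add: labeled_graph_def)
  have irrefl: "\<not> adjacent G x x" and adj_sym: "adjacent G x y = adjacent G y x" for x y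
    using G by (auto simp: labeled_graph_def)
  have K: "verts ?K = verts G" "vsign ?K = (vsign G)(v := flip_sign (vsign G v))"
    by (simp_all add: local_complementation_def toggle_adjacency_def)
  have "graph_form ?K x y = lc_form (graph_form G) v x y" for x y
    using adj_sym[of x v] irrefl[of v]
    by (auto simp: graph_form_def local_complementation_def toggle_adjacency_def mem_nbhd_iff[OF G] lc_form_def)
  then have "graph_form ?K = lc_form (graph_form G) v" by (intro ext)
  then show ?thesis
    using kauffman_bracket_same[OF H] fin v(2)
      bracket_lc_form[OF fin v(1), of "graph_form G" "vsign G"]
    by (simp add: K kauffman_bracket_eq graph_form_def)
qed

theorem theorem5p2:
  fixes G H :: "'v lgraph"
  assumes "labeled_graph G" and "labeled_graph H"
  shows "(omega_g2 G H \<longrightarrow> kauffman_bracket H = kauffman_bracket G) \<and>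
         (omega_g3 G H \<longrightarrow> kauffman_bracket H = kauffman_bracket G) \<and>
         (omega_g4 G H \<longrightarrow> kauffman_bracket H = kauffman_bracket G) \<and>
         (omega_g4' G H \<longrightarrow> kauffman_bracket H = kauffman_bracket G) \<and>
         (omega_g1 G H \<longrightarrow>
            kauffman_bracket H = - a_pow 3 * kauffman_bracket G \<or>
            kauffman_bracket H = - a_pow (-3) * kauffman_bracket G)"
proof (intro conjI impI)
  have inverse: "- a_pow 3 * (- a_pow (- 3) * P) = P" "- a_pow (- 3) * (- a_pow 3 * P) = P" for P
    by (simp_all add: mult.assoc[symmetric] a_pow_mult a_pow_0)
  show "kauffman_bracket H = - a_pow 3 * kauffman_bracket G \<or>
      kauffman_bracket H = - a_pow (-3) * kauffman_bracket G" if "omega_g1 G H"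
    using that kauffman_bracket_omega_g1_removal[OF assms(1), of H]
      kauffman_bracket_omega_g1_removal[OF assms(2), of G] inverse[of "kauffman_bracket H"]
    unfolding omega_g1_def by metis
qed (use assms in \<open>auto simp: omega_g2_def omega_g3_def kauffman_bracket_omega_g2_removal
  kauffman_bracket_omega_g3_step kauffman_bracket_omega_g4 kauffman_bracket_omega_g4'\<close>)

end
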